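(* Let $\mathcal{A}:\mathbb{R}^{m\times n}\to\mathbb{R}^l$ be a linear map whose isometry constant satisfies $\delta_1<1$, and let $\bm{b}\in\mathbb{R}^l$ be nonzero. Let $\{\lambda_j\}_{j\ge1}$ be a decreasing sequence of positive numbers with $\lambda_j\to0$, and for each $j$ let $\bar{\bm{X}}_{\lambda_j}$ be an optimal solution of $$\min_{\bm{X}\in\mathbb{R}^{m\times n}}\ \|\bm{X}\|_*-\|\bm{X}\|_F+\frac{1}{2\lambda_j}\|\mathcal{A}(\bm{X})-\bm{b}\|_2^2 .$$ If the problem $$\min_{\bm{X}\in\mathbb{R}^{m\times n}}\ \|\bm{X}\|_*-\|\bm{X}\|_F\quad\text{s.t. }\mathcal{A}(\bm{X})=\bm{b}$$ is feasible, then the sequence $\{\bar{\bm{X}}_{\lambda_j}\}$ is bounded and any of its accumulation points is an optimal solution of this constrained problem.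
   Context: $\|\cdot\|_*$ is the nuclear norm (sum of singular values), $\|\cdot\|_F$ the Frobenius norm. The isometry constant $\delta_1$ of $\mathcal{A}$ is the smallest number such that $(1-\delta_1)\|\bm{X}\|_F^2\le\|\mathcal{A}(\bm{X})\|_2^2\le(1+\delta_1)\|\bm{X}\|_F^2$ for all $\bm{X}\in\mathbb{R}^{m\times n}$ of rank at most $1$. *)

theory Defs
  imports "HOL-Analysis.Analysis"
begin

(* An m x n real matrix has type real^'n^'m.  The library norm on this type is the
   Frobenius norm: *)
lemma norm_matrix_eq_frobenius:
  fixes X :: "real^'n^'m"
  shows "norm X = sqrt (\<Sum>i\<in>UNIV. \<Sum>j\<in>UNIV. (X $ i $ j)\<^sup>2)"
  by (simp add: norm_vec_def L2_set_def sum_nonneg)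

definition singular_values :: "real^'n^'m \<Rightarrow> real set" where
  "singular_values X =
     {\<sigma>. \<sigma> \<ge> 0 \<and> (\<exists>v. v \<noteq> 0 \<and> (transpose X ** X) *v v = \<sigma>\<^sup>2 *\<^sub>R v)}"

(* The Gram matrix is symmetric, so geometric and algebraic multiplicities agree. *)
definition singular_value_mult :: "real^'n^'m \<Rightarrow> real \<Rightarrow> nat" where
  "singular_value_mult X \<sigma> = dim {v. (transpose X ** X) *v v = \<sigma>\<^sup>2 *\<^sub>R v}"

(* For n > m the set may contain an additional value 0, which does not affect the sum. *)
definition nuclear_norm :: "real^'n^'m \<Rightarrow> real" where
  "nuclear_norm X = (\<Sum>\<sigma>\<in>singular_values X. real (singular_value_mult X \<sigma>) * \<sigma>)"

lemma finite_singular_values: "finite (singular_values (X :: real^'n^'m))"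
proof -
  let ?G = "transpose X ** X"
  define w where "w \<sigma> = (SOME v. v \<noteq> 0 \<and> ?G *v v = \<sigma>\<^sup>2 *\<^sub>R v)" for \<sigma>
  have w: "w \<sigma> \<noteq> 0 \<and> ?G *v w \<sigma> = \<sigma>\<^sup>2 *\<^sub>R w \<sigma>" if "\<sigma> \<in> singular_values X" for \<sigma>
    unfolding w_def by (rule someI_ex) (use that in \<open>simp add: singular_values_def\<close>)
  have sym: "(?G *v u) \<bullet> v = u \<bullet> (?G *v v)" for u v
    by (simp add: dot_lmul_matrix matrix_transpose_mul flip: vector_transpose_matrix)
  have orth: "w \<sigma> \<bullet> w \<tau> = 0"
    if "\<sigma> \<in> singular_values X" "\<tau> \<in> singular_values X" "\<sigma> \<noteq> \<tau>" for \<sigma> \<tau>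
  proof -
    have "\<sigma>\<^sup>2 * (w \<sigma> \<bullet> w \<tau>) = \<tau>\<^sup>2 * (w \<sigma> \<bullet> w \<tau>)"
      using sym[of "w \<sigma>" "w \<tau>"] w[OF that(1)] w[OF that(2)] by simp
    moreover have "\<sigma>\<^sup>2 \<noteq> \<tau>\<^sup>2"
      using that by (auto simp: singular_values_def power2_eq_iff_nonneg)
    ultimately show ?thesis by simp
  qed
  have "pairwise orthogonal (w ` singular_values X)"
    by (auto simp: pairwise_def orthogonal_def intro: orth)
  moreover have "0 \<notin> w ` singular_values X"
    using w by force
  ultimately have "independent (w ` singular_values X)"
    by (rule pairwise_orthogonal_independent)
  then have "finite (w ` singular_values X)"
    by (rule independent_imp_finite)
  moreover have "inj_on w (singular_values X)"
    by (rule inj_onI, rule ccontr) (metis inner_eq_zero_iff orth w)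
  ultimately show ?thesis
    by (rule finite_imageD)
qed

definition isometry_bound :: "nat \<Rightarrow> (real^'n^'m \<Rightarrow> real^'l) \<Rightarrow> real \<Rightarrow> bool" where
  "isometry_bound r A \<delta> \<longleftrightarrow>
     (\<forall>X. rank X \<le> r \<longrightarrow>
        (1 - \<delta>) * (norm X)\<^sup>2 \<le> (norm (A X))\<^sup>2 \<and> (norm (A X))\<^sup>2 \<le> (1 + \<delta>) * (norm X)\<^sup>2)"

definition isometry_constant :: "nat \<Rightarrow> (real^'n^'m \<Rightarrow> real^'l) \<Rightarrow> real" where
  "isometry_constant r A = (LEAST \<delta>. isometry_bound r A \<delta>)"

(* The minimum is attained, so the LEAST above is meaningful. *)
lemma isometry_constant_least:
  fixes A :: "real^'n^'m \<Rightarrow> real^'l"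
  assumes "linear A" and "r \<ge> 1"
  shows "isometry_bound r A (isometry_constant r A)"
    and "isometry_bound r A \<delta> \<Longrightarrow> isometry_constant r A \<le> \<delta>"
proof -
  define S where "S = {\<delta>. isometry_bound r A \<delta>}"
  obtain B where B: "\<And>X. norm (A X) \<le> B * norm X"
    using linear_bounded[OF assms(1)] by blast
  have "(norm (A X))\<^sup>2 \<le> B\<^sup>2 * (norm X)\<^sup>2" for X
    using power_mono[OF B[of X], of 2] by (simp add: power_mult_distrib)
  moreover have "B\<^sup>2 * (norm X)\<^sup>2 \<le> (1 + (1 + B\<^sup>2)) * (norm X)\<^sup>2" for X :: "real^'n^'m"
    by (intro mult_right_mono) auto
  moreover have "(1 - (1 + B\<^sup>2)) * (norm X)\<^sup>2 \<le> (norm (A X))\<^sup>2" for X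
    by (rule order_trans[of _ 0]) (simp_all add: mult_nonneg_nonneg)
  ultimately have "1 + B\<^sup>2 \<in> S"
    unfolding S_def isometry_bound_def by (blast intro: order_trans)
  then have ne: "S \<noteq> {}" by blast
  define J :: "real^'n^'m" where "J = (\<chi> i j. 1)"
  have "columns J = {\<chi> i. 1}"
    by (auto simp: columns_def column_def J_def)
  then have "rank J \<le> 1"
    using dim_le_card'[of "columns J"] by (simp add: column_rank_def)
  have "norm J > 0"
    by (simp add: J_def vec_eq_iff)
  have nonneg: "\<delta> \<ge> 0" if "\<delta> \<in> S" for \<delta>
  proof -
    have "rank J \<le> r"
      using \<open>rank J \<le> 1\<close> \<open>r \<ge> 1\<close> by simp
    then have "(1 - \<delta>) * (norm J)\<^sup>2 \<le> (1 + \<delta>) * (norm J)\<^sup>2"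
      using that order_trans unfolding S_def isometry_bound_def by fast
    then show ?thesis
      using \<open>norm J > 0\<close> by (simp add: mult_le_cancel_right)
  qed
  then have bdd: "bdd_below S"
    by (meson bdd_belowI)
  have "S = (\<Inter>X\<in>{X. rank X \<le> r}. {\<delta>. (1 - \<delta>) * (norm X)\<^sup>2 \<le> (norm (A X))\<^sup>2}
      \<inter> {\<delta>. (norm (A X))\<^sup>2 \<le> (1 + \<delta>) * (norm X)\<^sup>2})"
    by (auto simp: S_def isometry_bound_def)
  moreover have "closed \<dots>"
    by (intro closed_INT ballI closed_Int closed_Collect_le continuous_intros)
  ultimately have "closed S"
    by simp
  then have "Inf S \<in> S"
    using ne bdd by (intro closed_contains_Inf)
  moreover have "Inf S \<le> \<delta>" if "\<delta> \<in> S" for \<delta>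
    using that bdd by (rule cInf_lower)
  ultimately have "isometry_constant r A = Inf S"
    unfolding isometry_constant_def S_def by (intro Least_equality) auto
  then show "isometry_bound r A (isometry_constant r A)"
    and "isometry_bound r A \<delta> \<Longrightarrow> isometry_constant r A \<le> \<delta>"
    using \<open>Inf S \<in> S\<close> \<open>\<And>\<delta>. \<delta> \<in> S \<Longrightarrow> Inf S \<le> \<delta>\<close> by (simp_all add: S_def)
qed

end

theory Submission
  imports Defs
begin

text \<open>The nuclear norm of \<open>X\<close> is the maximum of the inner products of \<open>X\<close> with matrices of
  operator norm at most 1, so it is continuous and positively homogeneous. It
  dominates the Frobenius norm, with equality only if the rank is at most 1. Since \<open>\<delta>\<^sub>1 < 1\<close>
  excludes nonzero matrices of rank at most 1 from the kernel of \<open>\<A>\<close>, compactness of the unit sphere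
  gives \<open>c > 0\<close> with \<open>\<parallel>X\<parallel>\<^sub>* - \<parallel>X\<parallel>\<^sub>F + \<parallel>\<A>(X)\<parallel> \<ge> c \<parallel>X\<parallel>\<^sub>F\<close>. Comparing a minimizer of the penalized
  problem with a feasible \<open>Y\<close> bounds its objective by that of \<open>Y\<close>, and its squared residual by
  \<open>2 \<lambda>\<^sub>j\<close> times that of \<open>Y\<close>.\<close>

section \<open>Orthonormal bases and the Frobenius inner product\<close>

definition orthonormal_basis :: "'a::euclidean_space set \<Rightarrow> bool" where
  "orthonormal_basis B \<longleftrightarrow>
     finite B \<and> pairwise orthogonal B \<and> (\<forall>v\<in>B. norm v = 1) \<and> span B = UNIV"

lemma orthonormal_basis_sum_inner:
  assumes "orthonormal_basis B"
  shows "(\<Sum>v\<in>B. (x \<bullet> v) * (y \<bullet> v)) = x \<bullet> y"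
proof -
  have "(\<Sum>v\<in>B. (x \<bullet> v) *\<^sub>R v) = x"
    using assms by (intro orthonormal_basis_expand) (auto simp: orthonormal_basis_def)
  moreover have "(\<Sum>v\<in>B. (x \<bullet> v) * (y \<bullet> v)) = (\<Sum>v\<in>B. (x \<bullet> v) *\<^sub>R v) \<bullet> y"
    by (simp add: inner_sum_left inner_commute[of y])
  ultimately show ?thesis by simp
qed

text \<open>Parseval's identity applied to each row, since the entries of \<open>X *v v\<close> are
  the inner products of the rows of \<open>X\<close> with \<open>v\<close>. The Frobenius inner
  product can thus be computed in a basis adapted to \<open>X\<close>.\<close>

lemma matrix_inner_orthonormal_basis:
  fixes X Y :: "real^'n^'m"
  assumes "orthonormal_basis B"
  shows "X \<bullet> Y = (\<Sum>v\<in>B. (X *v v) \<bullet> (Y *v v))"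
proof -
  have "X \<bullet> Y = (\<Sum>i\<in>UNIV. \<Sum>v\<in>B. (X $ i \<bullet> v) * (Y $ i \<bullet> v))"
    by (simp add: inner_vec_def[of X] orthonormal_basis_sum_inner[OF assms])
  also have "\<dots> = (\<Sum>v\<in>B. \<Sum>i\<in>UNIV. (X $ i \<bullet> v) * (Y $ i \<bullet> v))"
    by (rule sum.swap)
  finally show ?thesis
    by (simp add: inner_vec_def[of "X *v _"] matrix_vector_mul_component)
qed

section \<open>Singular vectors as eigenvectors of the Gram matrix\<close>

lemma inner_gram_matrix:
  fixes X :: "real^'n^'m"
  shows "((transpose X ** X) *v u) \<bullet> v = (X *v u) \<bullet> (X *v v)"
  by (simp only: matrix_vector_mul_assoc[symmetric] transpose_matrix_vector dot_lmul_matrix)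

text \<open>An eigenvector is a maximizer of the Rayleigh quotient on the subspace.\<close>

lemma gram_eigenvector_exists:
  fixes X :: "real^'n^'m"
  assumes S: "subspace S" "S \<noteq> {0}"
    and inv: "\<And>v. v \<in> S \<Longrightarrow> (transpose X ** X) *v v \<in> S"
  obtains v \<sigma> where "v \<in> S" "norm v = 1" "\<sigma> \<ge> 0" "(transpose X ** X) *v v = \<sigma>\<^sup>2 *\<^sub>R v"
proof -
  define K where "K = S \<inter> sphere 0 1"
  obtain u where u: "u \<in> S" "u \<noteq> 0"
    using S subspace_0 by blast
  have "compact K"
    unfolding K_def using closed_subspace[OF S(1)] by (intro closed_Int_compact) auto
  moreover have "inverse (norm u) *\<^sub>R u \<in> K"
    using u S(1) by (simp add: K_def subspace_scale)
  then have "K \<noteq> {}" by blast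
  moreover have "continuous_on K (\<lambda>v. norm (X *v v))"
    by (intro continuous_on_norm linear_continuous_on matrix_vector_mul_bounded_linear)
  ultimately obtain v where v: "v \<in> K" and max: "\<And>y. y \<in> K \<Longrightarrow> norm (X *v y) \<le> norm (X *v v)"
    by (meson continuous_attains_sup)
  define \<sigma> where "\<sigma> = norm (X *v v)"
  have bound: "(norm (X *v y))\<^sup>2 \<le> \<sigma>\<^sup>2 * (norm y)\<^sup>2" if "y \<in> S" for y
  proof (cases "y = 0")
    case False
    then have "inverse (norm y) *\<^sub>R y \<in> K"
      using that S(1) by (simp add: K_def subspace_scale)
    then have "norm (X *v y) \<le> \<sigma> * norm y"
      using max[of "inverse (norm y) *\<^sub>R y"] False
      by (simp add: \<sigma>_def matrix_vector_mult_scaleR field_simps)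
    then show ?thesis
      by (metis norm_ge_zero power_mono power_mult_distrib)
  qed (simp add: matrix_vector_mult_0_right)
  \<comment> \<open>\<open>w\<close> is the defect in the eigenvalue equation. It lies in
    \<open>S\<close> by invariance, so it is an admissible direction in which to perturb
    \<open>v\<close>.\<close>
  define w where "w = (transpose X ** X) *v v - \<sigma>\<^sup>2 *\<^sub>R v"
  have vS: "v \<in> S" "norm v = 1" using v by (auto simp: K_def)
  have wS: "w \<in> S"
    unfolding w_def using S(1) vS inv by (intro subspace_diff subspace_scale) auto
  have vv: "v \<bullet> v = 1" using vS(2) by (simp add: norm_eq_1)
  have XvXv: "(X *v v) \<bullet> (X *v v) = \<sigma>\<^sup>2" by (simp add: \<sigma>_def power2_norm_eq_inner)
  have ww: "w \<bullet> w = (X *v v) \<bullet> (X *v w) - \<sigma>\<^sup>2 * (v \<bullet> w)"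
    by (subst (1) w_def) (simp only: inner_diff_left inner_gram_matrix inner_scaleR_left)
  define c where "c = \<sigma>\<^sup>2 * (w \<bullet> w) - (X *v w) \<bullet> (X *v w)"
  \<comment> \<open>The Rayleigh bound at \<open>v + t *\<^sub>R w\<close>: the constant terms
    cancel and the terms linear in \<open>t\<close> combine to
    \<open>2 * t * (w \<bullet> w)\<close>.\<close>
  have quad: "2 * t * (w \<bullet> w) \<le> t\<^sup>2 * c" for t
  proof -
    have "v + t *\<^sub>R w \<in> S"
      using S(1) vS wS by (intro subspace_add subspace_scale)
    from bound[OF this] have
      "\<sigma>\<^sup>2 + 2 * t * ((X *v v) \<bullet> (X *v w)) + t\<^sup>2 * ((X *v w) \<bullet> (X *v w))
         \<le> \<sigma>\<^sup>2 * (1 + 2 * t * (v \<bullet> w) + t\<^sup>2 * (w \<bullet> w))"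
      unfolding power2_norm_eq_inner matrix_vector_right_distrib matrix_vector_mult_scaleR
      by (simp add: inner_add_left inner_add_right inner_commute vv XvXv
          power2_eq_square[of t] algebra_simps)
    then show ?thesis
      by (simp add: ww c_def algebra_simps)
  qed
  have "w \<bullet> w = 0"
  proof (rule ccontr)
    assume "w \<bullet> w \<noteq> 0"
    then have pos: "w \<bullet> w > 0" by (simp add: less_le)
    \<comment> \<open>Small enough that the quadratic term is at most
      \<open>t * (w \<bullet> w)\<close>, half of the linear one.\<close>
    define t where "t = (w \<bullet> w) / (\<bar>c\<bar> + 1)"
    have "t > 0" using pos by (simp add: t_def)
    then have "2 * (w \<bullet> w) \<le> t * c"
      using quad[of t] by (simp add: power2_eq_square)
    also have "\<dots> \<le> t * (\<bar>c\<bar> + 1)"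
      using \<open>t > 0\<close> by (intro mult_left_mono) auto
    also have "\<dots> = w \<bullet> w" by (simp add: t_def)
    finally show False using pos by simp
  qed
  then have "(transpose X ** X) *v v = \<sigma>\<^sup>2 *\<^sub>R v" by (simp add: w_def)
  then show ?thesis
    using that[of v \<sigma>] vS by (simp add: \<sigma>_def)
qed

lemma gram_eigenvectors_orthogonal:
  fixes X :: "real^'n^'m"
  assumes "(transpose X ** X) *v u = \<mu> *\<^sub>R u" "(transpose X ** X) *v v = \<nu> *\<^sub>R v" "\<mu> \<noteq> \<nu>"
  shows "orthogonal u v"
proof -
  have "\<mu> * (u \<bullet> v) = \<nu> * (u \<bullet> v)"
    using inner_gram_matrix[of X u v] inner_gram_matrix[of X v u] assms
    by (simp add: inner_commute)
  then show ?thesis using assms(3) by (simp add: orthogonal_def)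
qed

text \<open>Orthonormal bases of the eigenspaces, one for each singular value, are united.
  Multiplicities become cardinalities, so the nuclear norm turns into a sum over basis
  vectors.\<close>

lemma singular_basis_exists:
  fixes X :: "real^'n^'m"
  obtains B where "orthonormal_basis B" "pairwise (\<lambda>u v. orthogonal (X *v u) (X *v v)) B"
    "nuclear_norm X = (\<Sum>v\<in>B. norm (X *v v))"
proof -
  let ?G = "transpose X ** X"
  define E where "E \<sigma> = {v. ?G *v v = \<sigma>\<^sup>2 *\<^sub>R v}" for \<sigma>
  have subE: "subspace (E \<sigma>)" for \<sigma>
    by (auto simp: E_def subspace_def matrix_vector_right_distrib matrix_vector_mult_scaleR
        scaleR_add_right)
  have "\<exists>C. C \<subseteq> E \<sigma> \<and> pairwise orthogonal C \<and> (\<forall>v\<in>C. norm v = 1) \<and> independent C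
      \<and> card C = dim (E \<sigma>) \<and> span C = E \<sigma>" for \<sigma>
    by (rule orthonormal_basis_subspace[OF subE[of \<sigma>]]) blast
  then obtain C where C: "\<And>\<sigma>. C \<sigma> \<subseteq> E \<sigma>" "\<And>\<sigma>. pairwise orthogonal (C \<sigma>)"
    "\<And>\<sigma> v. v \<in> C \<sigma> \<Longrightarrow> norm v = 1" "\<And>\<sigma>. independent (C \<sigma>)"
    "\<And>\<sigma>. card (C \<sigma>) = dim (E \<sigma>)" "\<And>\<sigma>. span (C \<sigma>) = E \<sigma>"
    by metis
  let ?S = "singular_values X"
  define B where "B = (\<Union>\<sigma>\<in>?S. C \<sigma>)"
  have finC: "finite (C \<sigma>)" for \<sigma>
    using C(4) by (rule independent_imp_finite)
  have fin: "finite B"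
    unfolding B_def using finite_singular_values[of X] finC by blast
  have orth_C: "orthogonal u v" if "\<sigma> \<in> ?S" "\<tau> \<in> ?S" "u \<in> C \<sigma>" "v \<in> C \<tau>" "\<sigma> \<noteq> \<tau>" for \<sigma> \<tau> u v
  proof (rule gram_eigenvectors_orthogonal)
    show "?G *v u = \<sigma>\<^sup>2 *\<^sub>R u" "?G *v v = \<tau>\<^sup>2 *\<^sub>R v"
      using C(1) that by (auto simp: E_def)
    show "\<sigma>\<^sup>2 \<noteq> \<tau>\<^sup>2"
      using that by (auto simp: singular_values_def power2_eq_iff_nonneg)
  qed
  have orth: "pairwise orthogonal B"
    unfolding B_def pairwise_def using orth_C C(2) by (metis UN_E pairwiseD)
  have eigen: "\<exists>\<mu>. ?G *v v = \<mu> *\<^sub>R v" if "v \<in> B" for v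
    using that C(1) by (auto simp: B_def E_def)
  \<comment> \<open>Otherwise the orthogonal complement of \<open>B\<close> is nonzero and invariant
    under the Gram matrix, so it contains a unit eigenvector. That vector also lies in some
    \<open>E \<sigma>\<close>, hence in \<open>span B\<close>, and is orthogonal to itself.\<close>
  have "span B = UNIV"
  proof (rule ccontr)
    assume "span B \<noteq> UNIV"
    define S where "S = {x. \<forall>v\<in>B. orthogonal v x}"
    have "subspace S"
      by (auto simp: S_def subspace_def orthogonal_clauses)
    moreover have "S \<noteq> {0}"
    proof -
      have "span B \<subset> span UNIV" using \<open>span B \<noteq> UNIV\<close> by auto
      then obtain x where "x \<noteq> 0" "\<And>y. y \<in> span B \<Longrightarrow> orthogonal x y"
        using orthogonal_to_subspace_exists_gen by metis
      then have "x \<in> S" by (auto simp: S_def span_base orthogonal_commute)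
      then show ?thesis using \<open>x \<noteq> 0\<close> by auto
    qed
    moreover have "?G *v x \<in> S" if "x \<in> S" for x
    proof -
      have "v \<bullet> (?G *v x) = 0" if "v \<in> B" for v
      proof -
        obtain \<mu> where "?G *v v = \<mu> *\<^sub>R v" using eigen \<open>v \<in> B\<close> by blast
        then have "v \<bullet> (?G *v x) = \<mu> * (v \<bullet> x)"
          using inner_gram_matrix[of X v x] inner_gram_matrix[of X x v]
          by (simp add: inner_commute)
        then show ?thesis using \<open>x \<in> S\<close> \<open>v \<in> B\<close> by (simp add: S_def orthogonal_def)
      qed
      then show ?thesis by (simp add: S_def orthogonal_def)
    qed
    ultimately obtain v \<sigma> where v: "v \<in> S" "norm v = 1" "\<sigma> \<ge> 0" "?G *v v = \<sigma>\<^sup>2 *\<^sub>R v"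
      by (rule gram_eigenvector_exists) auto
    then have "\<sigma> \<in> ?S" "v \<in> E \<sigma>"
      by (auto simp: singular_values_def E_def intro!: exI[of _ v])
    then have "v \<in> span B"
      using C(6)[of \<sigma>] span_mono[of "C \<sigma>" B] by (auto simp: B_def)
    then have "orthogonal v v"
      using v(1) by (intro orthogonal_to_span[of v B v]) (auto simp: S_def orthogonal_commute)
    then show False using v(2) by (simp add: orthogonal_self)
  qed
  then have onb: "orthonormal_basis B"
    using fin orth C(3) by (auto simp: orthonormal_basis_def B_def)
  have "orthogonal (X *v u) (X *v v)" if "u \<in> B" "v \<in> B" "u \<noteq> v" for u v
  proof -
    obtain \<mu> where "?G *v u = \<mu> *\<^sub>R u" using eigen \<open>u \<in> B\<close> by blast
    moreover have "u \<bullet> v = 0" using orth that by (simp add: pairwise_def orthogonal_def)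
    ultimately show ?thesis
      using inner_gram_matrix[of X u v] by (simp add: orthogonal_def)
  qed
  then have orthX: "pairwise (\<lambda>u v. orthogonal (X *v u) (X *v v)) B"
    by (simp add: pairwise_def)
  have norm_C: "norm (X *v v) = \<sigma>" if "\<sigma> \<in> ?S" "v \<in> C \<sigma>" for \<sigma> v
  proof -
    have "(X *v v) \<bullet> (X *v v) = \<sigma>\<^sup>2"
      using inner_gram_matrix[of X v v] C(1)[of \<sigma>] C(3)[OF that(2)] that(2)
      by (auto simp: E_def norm_eq_1)
    then show ?thesis
      using that(1) by (simp add: norm_eq_sqrt_inner singular_values_def)
  qed
  \<comment> \<open>A common vector \<open>v\<close> would give
    \<open>\<sigma> = norm (X *v v) = \<tau>\<close>.\<close>
  have disj: "C \<sigma> \<inter> C \<tau> = {}" if "\<sigma> \<in> ?S" "\<tau> \<in> ?S" "\<sigma> \<noteq> \<tau>" for \<sigma> \<tau>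
    using norm_C that by blast
  have "(\<Sum>v\<in>B. norm (X *v v)) = (\<Sum>\<sigma>\<in>?S. \<Sum>v\<in>C \<sigma>. norm (X *v v))"
    unfolding B_def using finC disj finite_singular_values[of X] by (intro sum.UNION_disjoint) auto
  also have "\<dots> = (\<Sum>\<sigma>\<in>?S. real (card (C \<sigma>)) * \<sigma>)"
    by (intro sum.cong refl) (simp add: norm_C)
  also have "\<dots> = nuclear_norm X"
    by (simp add: nuclear_norm_def singular_value_mult_def C(5) E_def)
  finally show ?thesis
    using that[OF onb orthX] by simp
qed

section \<open>Duality with the operator norm, and its consequences\<close>

text \<open>In a singular basis of \<open>X\<close>, Cauchy-Schwarz bounds each summand of
  \<open>W \<bullet> X\<close> by \<open>norm (X *v v)\<close>.\<close>

lemma nuclear_norm_ge_inner: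
  fixes X W :: "real^'n^'m"
  assumes "\<And>v. norm (W *v v) \<le> norm v"
  shows "W \<bullet> X \<le> nuclear_norm X"
proof -
  obtain B where B: "orthonormal_basis B" "nuclear_norm X = (\<Sum>v\<in>B. norm (X *v v))"
    using singular_basis_exists by metis
  have "(W *v v) \<bullet> (X *v v) \<le> norm (X *v v)" if "v \<in> B" for v
  proof -
    have "(W *v v) \<bullet> (X *v v) \<le> norm (W *v v) * norm (X *v v)"
      by (rule norm_cauchy_schwarz)
    also have "\<dots> \<le> 1 * norm (X *v v)"
      using assms[of v] B(1) that by (intro mult_right_mono) (auto simp: orthonormal_basis_def)
    finally show ?thesis by simp
  qed
  then show ?thesis
    unfolding B(2) matrix_inner_orthonormal_basis[OF B(1)] by (rule sum_mono)
qed

text \<open>The witness is the partial isometry of the polar decomposition of \<^term>\<open>X\<close>.\<close>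

lemma nuclear_norm_eq_inner:
  fixes X :: "real^'n^'m"
  obtains W where "\<And>v. norm (W *v v) \<le> norm v" "W \<bullet> X = nuclear_norm X"
proof -
  obtain B where B: "orthonormal_basis B" "pairwise (\<lambda>u v. orthogonal (X *v u) (X *v v)) B"
    "nuclear_norm X = (\<Sum>v\<in>B. norm (X *v v))"
    by (rule singular_basis_exists)
  have fin: "finite B" using B(1) by (simp add: orthonormal_basis_def)
  \<comment> \<open>A right singular vector goes to the normalized left one; as
    \<open>sgn 0 = 0\<close>, basis vectors in the kernel of \<open>X\<close> go to 0.\<close>
  define f where "f x = (\<Sum>v\<in>B. (x \<bullet> v) *\<^sub>R sgn (X *v v))" for x
  have "linear f"
    unfolding f_def
    by (intro linearI) (simp_all add: inner_add_left scaleR_add_left sum.distrib scaleR_sum_right)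
  then have W: "matrix f *v x = f x" for x
    by (metis matrix_vector_mul(2))
  have "norm (f x) \<le> norm x" for x
  proof -
    define g where "g v = (x \<bullet> v) *\<^sub>R sgn (X *v v)" for v
    have "orthogonal (g u) (g v)" if "orthogonal (X *v u) (X *v v)" for u v
      using that by (simp add: g_def orthogonal_def sgn_div_norm)
    then have "pairwise (\<lambda>u v. orthogonal (g u) (g v)) B"
      using B(2) by (simp add: pairwise_def)
    \<comment> \<open>Pythagoras applies because the summands of \<open>f x\<close> are mutually
      orthogonal; each has norm at most \<open>\<bar>x \<bullet> v\<bar>\<close>.\<close>
    then have "(norm (f x))\<^sup>2 = (\<Sum>v\<in>B. (norm (g v))\<^sup>2)"
      using norm_sum_Pythagorean[OF fin, of g] by (simp add: f_def g_def)
    also have "\<dots> \<le> (\<Sum>v\<in>B. (x \<bullet> v) * (x \<bullet> v))"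
      by (intro sum_mono) (simp add: g_def norm_sgn power2_eq_square)
    also have "\<dots> = (norm x)\<^sup>2"
      by (simp add: orthonormal_basis_sum_inner[OF B(1)] power2_norm_eq_inner)
    finally show ?thesis
      by (simp add: power2_le_iff_abs_le)
  qed
  moreover have "matrix f \<bullet> X = nuclear_norm X"
  proof -
    have "f v = sgn (X *v v)" if "v \<in> B" for v
    proof -
      have "f v = (\<Sum>u\<in>B. if u = v then sgn (X *v v) else 0)"
        unfolding f_def using B(1) that
        by (intro sum.cong refl)
          (auto simp: orthonormal_basis_def pairwise_def orthogonal_def norm_eq_1)
      then show ?thesis using fin that by simp
    qed
    moreover have "sgn y \<bullet> y = norm y" for y :: "real^'m"
      by (cases "y = 0") (simp_all add: sgn_div_norm power2_norm_eq_inner[symmetric] power2_eq_square)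
    ultimately show ?thesis
      by (simp add: matrix_inner_orthonormal_basis[OF B(1)] W B(3))
  qed
  ultimately show ?thesis
    using that[of "matrix f"] by (simp add: W)
qed

text \<open>By duality: the optimal \<open>W\<close> of either side is tested against the
  other.\<close>

lemma nuclear_norm_scaleR:
  fixes X :: "real^'n^'m"
  assumes "t \<ge> 0"
  shows "nuclear_norm (t *\<^sub>R X) = t * nuclear_norm X"
proof (rule antisym)
  obtain W where W: "\<And>v. norm (W *v v) \<le> norm v" "W \<bullet> (t *\<^sub>R X) = nuclear_norm (t *\<^sub>R X)"
    using nuclear_norm_eq_inner by blast
  show "nuclear_norm (t *\<^sub>R X) \<le> t * nuclear_norm X"
    using mult_left_mono[OF nuclear_norm_ge_inner[OF W(1)] assms, of X] W(2) by simp
next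
  obtain W where W: "\<And>v. norm (W *v v) \<le> norm v" "W \<bullet> X = nuclear_norm X"
    using nuclear_norm_eq_inner by blast
  show "t * nuclear_norm X \<le> nuclear_norm (t *\<^sub>R X)"
    using nuclear_norm_ge_inner[OF W(1), of "t *\<^sub>R X"] W(2) by simp
qed

text \<open>The matrix \<open>W\<close> that is optimal for \<open>X\<close> is still admissible for
  \<open>Y\<close>, so the difference is at most \<open>W \<bullet> (X - Y)\<close>.\<close>

lemma nuclear_norm_diff_le:
  fixes X Y :: "real^'n^'m"
  shows "nuclear_norm X - nuclear_norm Y \<le> real CARD('n) * norm (X - Y)"
proof -
  obtain W where W: "\<And>v. norm (W *v v) \<le> norm v" "W \<bullet> X = nuclear_norm X"
    using nuclear_norm_eq_inner by blast
  have onb: "orthonormal_basis (Basis :: (real^'n) set)"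
    by (auto simp: orthonormal_basis_def pairwise_def orthogonal_def inner_Basis)
  have "nuclear_norm X - nuclear_norm Y \<le> W \<bullet> (X - Y)"
    using nuclear_norm_ge_inner[OF W(1), of Y] W(2) by (simp add: inner_diff_right)
  also have "\<dots> \<le> norm W * norm (X - Y)"
    by (rule norm_cauchy_schwarz)
  also have "norm W \<le> real CARD('n)"
  proof -
    have "(norm W)\<^sup>2 = (\<Sum>v\<in>Basis. (norm (W *v v))\<^sup>2)"
      by (simp add: power2_norm_eq_inner matrix_inner_orthonormal_basis[OF onb])
    also have "\<dots> \<le> (\<Sum>v\<in>(Basis :: (real^'n) set). 1)"
      using W(1) by (intro sum_mono) (metis norm_Basis norm_ge_zero power_le_one)
    also have "\<dots> = real CARD('n)" by simp
    \<comment> \<open>A crude bound in place of the square root of the dimension; any finite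
      Lipschitz constant gives continuity.\<close>
    also have "\<dots> \<le> (real CARD('n))\<^sup>2"
      by (intro self_le_power) (auto simp: Suc_le_eq)
    finally show ?thesis by (simp add: power2_le_iff_abs_le)
  qed
  finally show ?thesis by (simp add: mult_right_mono)
qed

lemma continuous_on_nuclear_norm: "continuous_on S (nuclear_norm :: real^'n^'m \<Rightarrow> real)"
proof -
  have "(real CARD('n))-lipschitz_on S (nuclear_norm :: real^'n^'m \<Rightarrow> real)"
  proof (rule lipschitz_onI)
    fix X Y :: "real^'n^'m"
    show "dist (nuclear_norm X) (nuclear_norm Y) \<le> real CARD('n) * dist X Y"
      using nuclear_norm_diff_le[of X Y] nuclear_norm_diff_le[of Y X]
      by (simp add: dist_norm norm_minus_commute abs_le_iff)
  qed simp
  then show ?thesis by (rule lipschitz_on_continuous_on)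
qed

section \<open>Nuclear norm against Frobenius norm\<close>

text \<open>In terms of the singular values both sides compare \<open>\<Sum>\<sigma>\<^sub>i\<close> with \<open>sqrt (\<Sum>\<sigma>\<^sub>i\<^sup>2)\<close>;
  equality leaves room for at most one nonzero \<open>\<sigma>\<^sub>i\<close>.\<close>

lemma
  fixes X :: "real^'n^'m"
  shows norm_le_nuclear_norm: "norm X \<le> nuclear_norm X"
    and rank_le_1_if_nuclear_norm_eq_norm: "nuclear_norm X = norm X \<Longrightarrow> rank X \<le> 1"
proof -
  obtain B where B: "orthonormal_basis B" "nuclear_norm X = (\<Sum>v\<in>B. norm (X *v v))"
    using singular_basis_exists by metis
  have fin: "finite B" using B(1) by (simp add: orthonormal_basis_def)
  let ?s = "\<lambda>v. norm (X *v v)"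
  have sq: "(norm X)\<^sup>2 = (\<Sum>v\<in>B. (?s v)\<^sup>2)"
    by (simp add: power2_norm_eq_inner matrix_inner_orthonormal_basis[OF B(1)])
  have nn: "nuclear_norm X \<ge> 0" by (simp add: B(2) sum_nonneg)
  have le: "?s v \<le> nuclear_norm X" if "v \<in> B" for v
    unfolding B(2) using fin that by (intro member_le_sum) auto
  \<comment> \<open>Only one factor of the square is expanded, so that it can be compared term by
    term with the sum of squares in \<open>sq\<close>.\<close>
  have sqn: "(nuclear_norm X)\<^sup>2 = (\<Sum>v\<in>B. ?s v * nuclear_norm X)"
    by (simp add: power2_eq_square B(2) sum_distrib_right)
  have term_le: "(?s v)\<^sup>2 \<le> ?s v * nuclear_norm X" if "v \<in> B" for v
    using le[OF that] by (simp add: power2_eq_square mult_left_mono)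
  have "(norm X)\<^sup>2 \<le> (nuclear_norm X)\<^sup>2"
    unfolding sq sqn using term_le by (rule sum_mono)
  then show "norm X \<le> nuclear_norm X"
    using nn by (rule power2_le_imp_le)
  assume "nuclear_norm X = norm X"
  then have "(\<Sum>v\<in>B. ?s v * nuclear_norm X - (?s v)\<^sup>2) = 0"
    using sq sqn by (simp add: sum_subtractf)
  \<comment> \<open>By \<open>term_le\<close> the summands are nonnegative, so a zero sum makes each
    of them vanish.\<close>
  then have eq: "?s v * nuclear_norm X = (?s v)\<^sup>2" if "v \<in> B" for v
    using that fin term_le by (subst (asm) sum_nonneg_eq_0_iff) auto
  have "\<exists>b. \<forall>v\<in>B. v \<noteq> b \<longrightarrow> X *v v = 0"
  proof (cases "\<exists>b\<in>B. X *v b \<noteq> 0")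
    case True
    then obtain b where b: "b \<in> B" "X *v b \<noteq> 0" by blast
    \<comment> \<open>Cancelling the nonzero \<open>?s b\<close> in \<open>eq\<close> shows that
      this single term exhausts the whole sum, so all others are 0.\<close>
    then have "nuclear_norm X = ?s b" using eq[OF b(1)] by (simp add: power2_eq_square)
    moreover have "nuclear_norm X = ?s b + (\<Sum>v\<in>B - {b}. ?s v)"
      unfolding B(2) using fin b(1) by (rule sum.remove)
    ultimately have "(\<Sum>v\<in>B - {b}. ?s v) = 0" by simp
    then have "\<forall>v\<in>B - {b}. ?s v = 0"
      using fin by (subst (asm) sum_nonneg_eq_0_iff) auto
    then show ?thesis by auto
  qed blast
  then obtain b where b: "\<And>v. v \<in> B \<Longrightarrow> v \<noteq> b \<Longrightarrow> X *v v = 0" by blast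
  have "range ((*v) X) = span ((*v) X ` B)"
    using B(1) by (simp add: linear_span_image orthonormal_basis_def)
  also have "\<dots> \<subseteq> span {X *v b}"
  proof (rule span_minimal)
    show "(*v) X ` B \<subseteq> span {X *v b}"
      using b by (metis image_subsetI insertI1 span_0 span_base)
  qed simp
  finally have "dim (range ((*v) X)) \<le> card {X *v b}"
    by (rule dim_le_card) simp
  then show "rank X \<le> 1" by (simp add: rank_dim_range)
qed

section \<open>Coercivity from compactness of the unit sphere\<close>

text \<open>By the isometry condition the continuous left-hand side has no zero on the unit sphere.\<close>

lemma nuclear_minus_frobenius_coercive:
  fixes A :: "real^'n^'m \<Rightarrow> real^'l"
  assumes "linear A" "isometry_constant 1 A < 1"
  obtains c where "c > 0" "\<And>X. nuclear_norm X - norm X + norm (A X) \<ge> c * norm X"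
proof -
  define g where "g X = nuclear_norm X - norm X + norm (A X)" for X
  let ?K = "sphere (0 :: real^'n^'m) 1"
  have "continuous_on ?K g"
    unfolding g_def
    by (intro continuous_intros continuous_on_nuclear_norm linear_continuous_on)
      (simp add: assms(1) linear_conv_bounded_linear[symmetric])
  moreover have "?K \<noteq> {}" by simp
  ultimately obtain Z where Z: "Z \<in> ?K" and min: "\<And>Y. Y \<in> ?K \<Longrightarrow> g Z \<le> g Y"
    using continuous_attains_inf[OF compact_sphere] by metis
  have "g Z > 0"
  proof (rule ccontr)
    assume "\<not> g Z > 0"
    then have "nuclear_norm Z = norm Z" "A Z = 0"
      using norm_le_nuclear_norm[of Z] norm_ge_zero[of "A Z"] unfolding g_def
      by (linarith, smt (verit) norm_eq_zero)
    then have "rank Z \<le> 1" using rank_le_1_if_nuclear_norm_eq_norm by blast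
    then have "(1 - isometry_constant 1 A) * (norm Z)\<^sup>2 \<le> (norm (A Z))\<^sup>2"
      using isometry_constant_least(1)[OF assms(1), of 1] unfolding isometry_bound_def by blast
    then show False using Z \<open>A Z = 0\<close> assms(2) by simp
  qed
  moreover have "g X \<ge> g Z * norm X" for X
  proof (cases "X = 0")
    case True
    then show ?thesis
      using norm_le_nuclear_norm[of X] by (simp add: g_def)
  next
    case False
    \<comment> \<open>\<open>g\<close> is positively homogeneous of degree 1, so its minimum on the
      sphere controls it at every nonzero \<open>X\<close>.\<close>
    define Y where "Y = inverse (norm X) *\<^sub>R X"
    have "X = norm X *\<^sub>R Y" "Y \<in> ?K" using False by (simp_all add: Y_def)
    then have "g X = g (norm X *\<^sub>R Y)" by simp
    also have "\<dots> = norm X * g Y"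
      using assms(1) by (simp add: g_def nuclear_norm_scaleR linear_scale algebra_simps)
    finally have "g X = norm X * g Y" .
    then show ?thesis
      using min[OF \<open>Y \<in> ?K\<close>] by (simp add: mult.commute mult_left_mono)
  qed
  ultimately show ?thesis using that[of "g Z"] by (simp add: g_def)
qed

section \<open>Boundedness and accumulation points of the penalized minimizers\<close>

theorem theorem14:
  fixes A :: "real^'n^'m \<Rightarrow> real^'l"
    and b :: "real^'l"
    and lam :: "nat \<Rightarrow> real"
    and Xbar :: "nat \<Rightarrow> real^'n^'m"
  assumes "linear A"
    and "isometry_constant 1 A < 1"
    and "b \<noteq> 0"
    and "decseq lam"
    and "\<And>j. lam j > 0"
    and "lam \<longlonglongrightarrow> 0"
    and "\<And>j. is_arg_min
           (\<lambda>X. nuclear_norm X - norm X + 1 / (2 * lam j) * (norm (A X - b))\<^sup>2)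
           (\<lambda>X. True) (Xbar j)"
    and "\<exists>X. A X = b"
  shows "bounded (range Xbar) \<and>
         (\<forall>X r. strict_mono r \<longrightarrow> (Xbar \<circ> r) \<longlonglongrightarrow> X \<longrightarrow>
            is_arg_min (\<lambda>X. nuclear_norm X - norm X) (\<lambda>X. A X = b) X)"
proof -
  define f where "f X = nuclear_norm X - norm X" for X :: "real^'n^'m"
  have f_nonneg: "f X \<ge> 0" for X
    using norm_le_nuclear_norm[of X] by (simp add: f_def)
  \<comment> \<open>A feasible \<open>Y\<close> has no penalty, so its penalized objective is just
    \<open>f Y\<close>.\<close>
  have opt: "f (Xbar j) + (norm (A (Xbar j) - b))\<^sup>2 / (2 * lam j) \<le> f Y" if "A Y = b" for j Y
    using assms(7)[of j] that by (auto simp: is_arg_min_def f_def not_less dest: spec[of _ Y])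
  have f_le: "f (Xbar j) \<le> f Y" if "A Y = b" for j Y
  proof -
    have "(norm (A (Xbar j) - b))\<^sup>2 / (2 * lam j) \<ge> 0"
      using assms(5)[of j] by simp
    then show ?thesis using opt[OF that, of j] by linarith
  qed
  have res_le: "(norm (A (Xbar j) - b))\<^sup>2 \<le> 2 * lam j * f Y" if "A Y = b" for j Y
  proof -
    have "(norm (A (Xbar j) - b))\<^sup>2 / (2 * lam j) \<le> f Y"
      using opt[OF that, of j] f_nonneg[of "Xbar j"] by linarith
    then show ?thesis using assms(5)[of j] by (simp add: divide_le_eq mult.commute)
  qed
  obtain Y where Y: "A Y = b" using assms(8) by blast
  have lim0: "(\<lambda>j. norm (A (Xbar j) - b)) \<longlonglongrightarrow> 0"
  proof -
    have "(\<lambda>j. 2 * lam j * f Y) \<longlonglongrightarrow> 2 * 0 * f Y"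
      by (intro tendsto_intros assms(6))
    then have "(\<lambda>j. 2 * lam j * f Y) \<longlonglongrightarrow> 0" by simp
    then have "(\<lambda>j. (norm (A (Xbar j) - b))\<^sup>2) \<longlonglongrightarrow> 0"
      by (rule Lim_null_comparison[rotated]) (simp add: res_le[OF Y])
    then show ?thesis
      using tendsto_real_sqrt[of "\<lambda>j. (norm (A (Xbar j) - b))\<^sup>2" 0 sequentially] by simp
  qed
  have "bounded (range Xbar)"
  proof -
    obtain c where c: "c > 0" "\<And>X. c * norm X \<le> f X + norm (A X)"
      using nuclear_minus_frobenius_coercive[OF assms(1,2)] by (metis f_def)
    have "Bseq (\<lambda>j. norm (A (Xbar j) - b))"
      using lim0 by (intro convergent_imp_Bseq convergentI)
    then obtain K where K: "\<And>j. norm (A (Xbar j) - b) \<le> K"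
      by (auto simp: Bseq_def)
    have "norm (Xbar j) \<le> (f Y + (K + norm b)) / c" for j
    proof -
      \<comment> \<open>Coercivity at \<open>Xbar j\<close>: \<open>f\<close> is at most
        \<open>f Y\<close>, and bounded residuals bound \<open>A (Xbar j)\<close>.\<close>
      have "c * norm (Xbar j) \<le> f Y + (K + norm b)"
        using c(2)[of "Xbar j"] f_le[OF Y, of j] K[of j] norm_triangle_sub[of "A (Xbar j)" b]
        by linarith
      then show ?thesis using c(1) by (simp add: le_divide_eq mult.commute)
    qed
    then show ?thesis by (auto simp: bounded_iff)
  qed
  \<comment> \<open>Accumulation points are taken as limits of subsequences. Vanishing residuals
    make the limit feasible; continuity of \<open>f\<close> carries \<open>f_le\<close> to it for
    every feasible \<open>Z\<close>.\<close>
  moreover have "is_arg_min (\<lambda>X. nuclear_norm X - norm X) (\<lambda>X. A X = b) X"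
    if r: "strict_mono r" and lim: "(Xbar \<circ> r) \<longlonglongrightarrow> X" for X r
  proof -
    have "isCont A X"
      using assms(1) by (simp add: linear_continuous_at linear_conv_bounded_linear[symmetric])
    then have "(\<lambda>j. A ((Xbar \<circ> r) j)) \<longlonglongrightarrow> A X"
      using lim by (rule isCont_tendsto_compose)
    then have "(\<lambda>j. norm (A ((Xbar \<circ> r) j) - b)) \<longlonglongrightarrow> norm (A X - b)"
      by (intro tendsto_intros)
    moreover have "(\<lambda>j. norm (A ((Xbar \<circ> r) j) - b)) \<longlonglongrightarrow> 0"
      using LIMSEQ_subseq_LIMSEQ[OF lim0 r] by (simp add: o_def)
    ultimately have "norm (A X - b) = 0" by (rule LIMSEQ_unique)
    then have "A X = b" by simp
    moreover have "f X \<le> f Z" if "A Z = b" for Z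
    proof (rule LIMSEQ_le_const2)
      have "isCont f X"
        using continuous_on_nuclear_norm[of UNIV] unfolding f_def
        by (intro continuous_intros) (auto simp: continuous_on_eq_continuous_at)
      then show "(\<lambda>j. f ((Xbar \<circ> r) j)) \<longlonglongrightarrow> f X"
        using lim by (rule isCont_tendsto_compose)
      show "\<exists>N. \<forall>j\<ge>N. f ((Xbar \<circ> r) j) \<le> f Z"
        using f_le[OF that] by simp
    qed
    ultimately show ?thesis
      by (auto simp: is_arg_min_def f_def not_less)
  qed
  ultimately show ?thesis by blast
qed

end
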